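(* There are a set of formulas $\Gamma$ and a formula $A$ of $\mathscr{L}$ such that $\Gamma \models A$ and $\Gamma \not\vdash_{\texttt{IL}} A$.
   Context: The meta-language reasoning is classical. $\vdash_{\texttt{IL}}$ is derivability in intuitionistic propositional logic. The language $\mathscr{L}$ has formulas generated by $X ::= p \mid \bot \mid X\wedge X \mid X \vee X \mid X \rightarrow X$, where $p$ ranges over propositional atoms; the $p$'s and $\bot$ are the atoms. $\neg A$ abbreviates $A \rightarrow \bot$. An atomic base $\mathfrak{B}$ is a countable set of production rules with premises $A_1,\dots,A_n$ ($n\ge 0$) and conclusion $B$, where $A_i, B$ are atoms and $A_i \neq \bot$; $\vdash_{\mathfrak{B}}$ denotes derivability of atoms from no assumptions using these rules. Bases are always required to be consistent: $\not\vdash_{\mathfrak{B}} \bot$. For a set of formulas $\Gamma$ and formula $A$, $\Gamma \models_{\mathfrak{B}} A$ is defined as follows. If $\Gamma=\emptyset$: for $A$ an atom, $\models_{\mathfrak{B}} A$ iff $\vdash_{\mathfrak{B}} A$; $\models_{\mathfrak{B}} B\wedge C$ iff $\models_{\mathfrak{B}} B$ and $\models_{\mathfrak{B}} C$; $\models_{\mathfrak{B}} B\vee C$ iff $\models_{\mathfrak{B}} B$ or $\models_{\mathfrak{B}} C$; $\models_{\mathfrak{B}} B\rightarrow C$ iff $\{B\} \models_{\mathfrak{B}} C$. If $\Gamma\neq\emptyset$: $\Gamma \models_{\mathfrak{B}} A$ iff (if $\models_{\mathfrak{B}} C$ for every $C\in\Gamma$, then $\models_{\mathfrak{B}} A$).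 Finally $\Gamma \models A$ iff $\Gamma \models_{\mathfrak{B}} A$ for every base $\mathfrak{B}$. *)

theory Defs
  imports "HOL-Library.Countable_Set"
begin

datatype 'p atom = Prop 'p | Falsum

datatype 'p form =
    Atom "'p atom"
  | Conj "'p form" "'p form"
  | Disj "'p form" "'p form"
  | Imp "'p form" "'p form"

abbreviation Bot :: "'p form"
  where "Bot \<equiv> Atom Falsum"

abbreviation Neg :: "'p form \<Rightarrow> 'p form"
  where "Neg A \<equiv> Imp A Bot"

text \<open>Intuitionistic natural deduction; the left-hand side may be infinite.\<close>

inductive il_derives :: "'p form set \<Rightarrow> 'p form \<Rightarrow> bool" (infix \<open>\<turnstile>\<^sub>I\<^sub>L\<close> 50) where
  assm: "A \<in> \<Gamma> \<Longrightarrow> \<Gamma> \<turnstile>\<^sub>I\<^sub>L A"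
| botE: "\<Gamma> \<turnstile>\<^sub>I\<^sub>L Bot \<Longrightarrow> \<Gamma> \<turnstile>\<^sub>I\<^sub>L A"
| conjI: "\<Gamma> \<turnstile>\<^sub>I\<^sub>L A \<Longrightarrow> \<Gamma> \<turnstile>\<^sub>I\<^sub>L B \<Longrightarrow> \<Gamma> \<turnstile>\<^sub>I\<^sub>L Conj A B"
| conjE1: "\<Gamma> \<turnstile>\<^sub>I\<^sub>L Conj A B \<Longrightarrow> \<Gamma> \<turnstile>\<^sub>I\<^sub>L A"
| conjE2: "\<Gamma> \<turnstile>\<^sub>I\<^sub>L Conj A B \<Longrightarrow> \<Gamma> \<turnstile>\<^sub>I\<^sub>L B"
| disjI1: "\<Gamma> \<turnstile>\<^sub>I\<^sub>L A \<Longrightarrow> \<Gamma> \<turnstile>\<^sub>I\<^sub>L Disj A B"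
| disjI2: "\<Gamma> \<turnstile>\<^sub>I\<^sub>L B \<Longrightarrow> \<Gamma> \<turnstile>\<^sub>I\<^sub>L Disj A B"
| disjE: "\<Gamma> \<turnstile>\<^sub>I\<^sub>L Disj A B \<Longrightarrow> insert A \<Gamma> \<turnstile>\<^sub>I\<^sub>L C \<Longrightarrow> insert B \<Gamma> \<turnstile>\<^sub>I\<^sub>L C \<Longrightarrow> \<Gamma> \<turnstile>\<^sub>I\<^sub>L C"
| impI: "insert A \<Gamma> \<turnstile>\<^sub>I\<^sub>L B \<Longrightarrow> \<Gamma> \<turnstile>\<^sub>I\<^sub>L Imp A B"
| impE: "\<Gamma> \<turnstile>\<^sub>I\<^sub>L Imp A B \<Longrightarrow> \<Gamma> \<turnstile>\<^sub>I\<^sub>L A \<Longrightarrow> \<Gamma> \<turnstile>\<^sub>I\<^sub>L B"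

text \<open>A production rule is a pair of its list of premises and its conclusion.\<close>

type_synonym 'p rule = "'p atom list \<times> 'p atom"

inductive base_derives :: "'p rule set \<Rightarrow> 'p atom \<Rightarrow> bool" for \<BB> :: "'p rule set" where
  rule: "(As, b) \<in> \<BB> \<Longrightarrow> (\<And>a. a \<in> set As \<Longrightarrow> base_derives \<BB> a) \<Longrightarrow> base_derives \<BB> b"

definition atomic_base :: "'p rule set \<Rightarrow> bool" where
  "atomic_base \<BB> \<longleftrightarrow>
     countable \<BB> \<and> (\<forall>(As, b) \<in> \<BB>. Falsum \<notin> set As) \<and> \<not> base_derives \<BB> Falsum"

text \<open>
  Validity on a base without assumptions. To keep the recursion structural, the
  clause for implication has the one-premise instance of consequence on the base
  unfolded; \<open>base_consequence_clauses\<close> recovers it in its original form.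
\<close>

primrec base_valid :: "'p rule set \<Rightarrow> 'p form \<Rightarrow> bool" where
  "base_valid \<BB> (Atom a) \<longleftrightarrow> base_derives \<BB> a"
| "base_valid \<BB> (Conj B C) \<longleftrightarrow> base_valid \<BB> B \<and> base_valid \<BB> C"
| "base_valid \<BB> (Disj B C) \<longleftrightarrow> base_valid \<BB> B \<or> base_valid \<BB> C"
| "base_valid \<BB> (Imp B C) \<longleftrightarrow> (base_valid \<BB> B \<longrightarrow> base_valid \<BB> C)"

definition base_consequence :: "'p rule set \<Rightarrow> 'p form set \<Rightarrow> 'p form \<Rightarrow> bool" where
  "base_consequence \<BB> \<Gamma> A \<longleftrightarrow>
     (if \<Gamma> = {} then base_valid \<BB> A
      else (\<forall>C\<in>\<Gamma>. base_valid \<BB> C) \<longrightarrow> base_valid \<BB> A)"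

lemma base_consequence_clauses:
  "base_consequence \<BB> {} (Atom a) \<longleftrightarrow> base_derives \<BB> a"
  "base_consequence \<BB> {} (Conj B C) \<longleftrightarrow> base_consequence \<BB> {} B \<and> base_consequence \<BB> {} C"
  "base_consequence \<BB> {} (Disj B C) \<longleftrightarrow> base_consequence \<BB> {} B \<or> base_consequence \<BB> {} C"
  "base_consequence \<BB> {} (Imp B C) \<longleftrightarrow> base_consequence \<BB> {B} C"
  "\<Gamma> \<noteq> {} \<Longrightarrow> base_consequence \<BB> \<Gamma> A \<longleftrightarrow>
     ((\<forall>C\<in>\<Gamma>. base_consequence \<BB> {} C) \<longrightarrow> base_consequence \<BB> {} A)"
  by (simp_all add: base_consequence_def)

definition consequence :: "'p form set \<Rightarrow> 'p form \<Rightarrow> bool" (infix \<open>\<TTurnstile>\<close> 50) where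
  "\<Gamma> \<TTurnstile> A \<longleftrightarrow> (\<forall>\<BB>. atomic_base \<BB> \<longrightarrow> base_consequence \<BB> \<Gamma> A)"

end

theory Submission
  imports Defs
begin

text \<open>
  On a fixed base, implication is read truth-functionally, with no passage to extensions
  of the base, so excluded middle is valid on every base. It is refuted intuitionistically
  in the three-element Heyting chain, with every propositional letter at the middle element.
\<close>

primrec chain_value :: "'p form \<Rightarrow> nat" where
  "chain_value (Atom a) = (case a of Prop p \<Rightarrow> 1 | Falsum \<Rightarrow> 0)"
| "chain_value (Conj B C) = min (chain_value B) (chain_value C)"
| "chain_value (Disj B C) = max (chain_value B) (chain_value C)"
| "chain_value (Imp B C) = (if chain_value B \<le> chain_value C then 2 else chain_value C)"

text \<open>Lower bounds \<open>m\<close> stand in for the infimum of the values of \<Gamma>, which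
  may be infinite or empty; \<open>m \<le> 2\<close> keeps them below the top of the chain.\<close>

lemma chain_value_sound:
  assumes "\<Gamma> \<turnstile>\<^sub>I\<^sub>L A" and "m \<le> 2" and "\<forall>C\<in>\<Gamma>. m \<le> chain_value C"
  shows "m \<le> chain_value A"
  using assms
proof (induction arbitrary: m rule: il_derives.induct)
  case (disjE \<Gamma> A B C)
  have "m \<le> chain_value A \<or> m \<le> chain_value B"
    using disjE.IH(1)[OF disjE.prems] by auto
  then show ?case
    using disjE.IH(2,3)[of m] disjE.prems by auto
next
  case (impI A \<Gamma> B)
  \<comment> \<open>Residuation: lowering the bound to this minimum also covers the discharged
    assumption \<open>A\<close>.\<close>
  have "min m (chain_value A) \<le> chain_value B"
    using impI.prems by (intro impI.IH) (simp_all add: min.coboundedI1)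
  then show ?case
    using impI.prems(1) by (auto simp: min_le_iff_disj)
next
  case (impE \<Gamma> A B)
  show ?case
    using impE.IH(1)[OF impE.prems] impE.IH(2)[OF impE.prems] by (auto split: if_splits)
next
  case (botE \<Gamma> A)
  show ?case
    using botE.IH[OF botE.prems] by simp
qed (simp_all add: le_max_iff_disj)

lemma excluded_middle_valid: "{} \<TTurnstile> Disj A (Neg A)"
  by (auto simp: consequence_def base_consequence_def)

lemma excluded_middle_not_derivable:
  "\<not> {} \<turnstile>\<^sub>I\<^sub>L Disj (Atom (Prop p)) (Neg (Atom (Prop p)))"
  \<comment> \<open>Without assumptions the bound may be the top 2, but this formula has value max 1
    0 = 1.\<close>
  using chain_value_sound[of "{}" "Disj (Atom (Prop p)) (Neg (Atom (Prop p)))" 2] by auto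

theorem theorem1:
  "\<exists>(\<Gamma> :: 'p form set) (A :: 'p form). \<Gamma> \<TTurnstile> A \<and> \<not> (\<Gamma> \<turnstile>\<^sub>I\<^sub>L A)"
proof (intro exI)
  fix p :: 'p
  let ?A = "Disj (Atom (Prop p)) (Neg (Atom (Prop p)))"
  show "{} \<TTurnstile> ?A \<and> \<not> ({} \<turnstile>\<^sub>I\<^sub>L ?A)"
    by (simp add: excluded_middle_valid excluded_middle_not_derivable)
qed

end
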